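(* Assume that for every $P\in\mathcal P$ the $p$-values $p_1,\dots,p_m$ are mutually independent and that $p_i$ is uniformly distributed on $[0,1]$ for every $i\in\mathcal H_0(P)$. Then the plug-in BH procedure using the modified Pounds–Cheng estimator $$\widehat m_0^{\mathrm{PC,new}}=2+2\sum_{i=1}^m p_i$$ controls the FDR at level $\alpha$.
   Context: Setting: an observation $X$ has distribution $P$ belonging to a set $\mathcal P$ of possible distributions. There are $m$ null hypotheses $H_{0,1},\dots,H_{0,m}$ on $P$; $\mathcal H_0(P)\subseteq\{1,\dots,m\}$ is the set of indices $i$ such that $H_{0,i}$ is satisfied by $P$. The $p$-values are $[0,1]$-valued random variables $p_i=p_i(X)$. Plug-in BH procedure at level $\alpha\in(0,1)$ with estimator $\widehat m_0=\widehat m_0(p_1,\dots,p_m)$: let $p_{(1)}\le\dots\le p_{(m)}$ be the ordered $p$-values with corresponding null hypotheses $H_{(1)},\dots,H_{(m)}$, and $p_{(0)}:=0$; reject $H_{(1)},\dots,H_{(\hat k)}$, where $\hat k=\max\{\ell\in\{0,\dots,m\}: p_{(\ell)}\le \ell\alpha/\widehat m_0\}$. FDR is the expectation of the number of rejected true null hypotheses divided by $\max(1,\text{number of rejections})$. Controlling the FDR at level $\alpha$ means that this expectation is $\le\alpha$ for every $P\in\mathcal P$. *)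

theory Defs
  imports "HOL-Probability.Probability"
begin

text \<open>
  Hypotheses are indexed by \<open>{1..m}\<close>. A vector of \<open>p\<close>-values is a function \<open>q :: nat \<Rightarrow> real\<close>,
  of which only the values on \<open>{1..m}\<close> matter.
\<close>

definition true_nulls :: "nat \<Rightarrow> (nat \<Rightarrow> 'a measure \<Rightarrow> bool) \<Rightarrow> 'a measure \<Rightarrow> nat set" where
  "true_nulls m H P = {i \<in> {1..m}. H i P}"

text \<open>
  The \<open>l\<close>-th entry (counted from 1) of the following list is the index of the hypothesis
  \<open>H\<^sub>(\<^sub>l\<^sub>)\<close>. Ties are broken by index; this does not affect the rejected set below, since
  \<open>p\<^sub>(\<^sub>k\<^sub>)\<close> \<open>=\<close> \<open>p\<^sub>(\<^sub>k\<^sub>+\<^sub>1\<^sub>)\<close> never holds for the maximal \<open>k\<close> when the estimator is positive.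
\<close>

definition ordered_hyps :: "nat \<Rightarrow> (nat \<Rightarrow> real) \<Rightarrow> nat list" where
  "ordered_hyps m q = sort_key q [1..<Suc m]"

definition ordered_pval :: "nat \<Rightarrow> (nat \<Rightarrow> real) \<Rightarrow> nat \<Rightarrow> real" where
  "ordered_pval m q l = (if l = 0 then 0 else q (ordered_hyps m q ! (l - 1)))"

definition plugin_BH_count ::
  "nat \<Rightarrow> real \<Rightarrow> ((nat \<Rightarrow> real) \<Rightarrow> real) \<Rightarrow> (nat \<Rightarrow> real) \<Rightarrow> nat" where
  "plugin_BH_count m \<alpha> m0_est q =
     Max {l \<in> {0..m}. ordered_pval m q l \<le> real l * \<alpha> / m0_est q}"

definition plugin_BH ::
  "nat \<Rightarrow> real \<Rightarrow> ((nat \<Rightarrow> real) \<Rightarrow> real) \<Rightarrow> (nat \<Rightarrow> real) \<Rightarrow> nat set" where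
  "plugin_BH m \<alpha> m0_est q = set (take (plugin_BH_count m \<alpha> m0_est q) (ordered_hyps m q))"

definition m0_PC_new :: "nat \<Rightarrow> (nat \<Rightarrow> real) \<Rightarrow> real" where
  "m0_PC_new m q = 2 + 2 * (\<Sum>i=1..m. q i)"

definition FDR :: "'a measure \<Rightarrow> nat set \<Rightarrow> ('a \<Rightarrow> nat set) \<Rightarrow> real" where
  "FDR P N R = (\<integral>x. real (card (R x \<inter> N)) / max 1 (real (card (R x))) \<partial>P)"

definition controls_FDR ::
  "'a measure set \<Rightarrow> nat \<Rightarrow> (nat \<Rightarrow> 'a measure \<Rightarrow> bool) \<Rightarrow> ('a \<Rightarrow> nat set) \<Rightarrow> real \<Rightarrow> bool" where
  "controls_FDR \<P> m H R \<alpha> \<longleftrightarrow> (\<forall>P\<in>\<P>. FDR P (true_nulls m H P) R \<le> \<alpha>)"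

end

theory Submission
  imports Defs
begin

text \<open>
  The number of rejections is antitone in each \<open>p\<close>-value, since raising a \<open>p\<close>-value also raises the
  estimator. Conditionally on the other \<open>p\<close>-values, a true null \<open>i\<close> therefore contributes at most
  \<open>\<alpha> / m\<^sub>0(p\<^sub>i := 0)\<close> to the FDR, where \<open>m\<^sub>0(p\<^sub>i := 0) \<ge> 2 (1 + S)\<close> and \<open>S\<close> is the sum of the
  \<open>n - 1\<close> other independent uniform null \<open>p\<close>-values. By convexity \<open>E (1 / (1 + S))\<close> only grows when
  the uniform variables are replaced by fair coin flips, for which it is at most \<open>2 / n\<close>. Summing
  \<open>\<alpha> / 2 \<cdot> 2 / n\<close> over the \<open>n\<close> true nulls gives \<open>\<alpha>\<close>.
\<close>

section \<open>Order statistics and the rejection count\<close>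

lemma ordered_hyps_simps [simp]:
  "set (ordered_hyps m q) = {1..m}"
  "length (ordered_hyps m q) = m"
  "distinct (ordered_hyps m q)"
  by (auto simp: ordered_hyps_def)

text \<open>The indices with p-value at most \<open>t\<close> form an initial segment of the sorted
  list, so comparing an order statistic with \<open>t\<close> amounts to counting. This frees the
  study of the rejection count from sorting and tie-breaking.\<close>

lemma ordered_pval_le_iff:
  assumes "1 \<le> l" "l \<le> m"
  shows "ordered_pval m q l \<le> t \<longleftrightarrow> l \<le> card {i\<in>{1..m}. q i \<le> t}"
proof -
  define xs where "xs = ordered_hyps m q"
  have len: "length xs = m" and set: "set xs = {1..m}" and dist: "distinct xs"
    by (simp_all add: xs_def)
  have mono: "q (xs ! a) \<le> q (xs ! b)" if "a \<le> b" "b < m" for a b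
    using sorted_nth_mono[of "map q xs" a b] that len
    by (simp add: xs_def ordered_hyps_def)
  have "l \<le> card {i\<in>{1..m}. q i \<le> t}" if "q (xs ! (l - 1)) \<le> t"
  proof -
    have "q i \<le> t" if "i \<in> set (take l xs)" for i
    proof -
      have "i \<in> (!) xs ` {0..<l}"
        by (subst nth_image) (use that len assms in simp_all)
      then obtain a where "a < l" "i = xs ! a"
        by auto
      moreover from this have "a \<le> l - 1" "l - 1 < m"
        using assms by auto
      ultimately show ?thesis
        using mono \<open>q (xs ! (l - 1)) \<le> t\<close> order_trans by blast
    qed
    hence "set (take l xs) \<subseteq> {i\<in>{1..m}. q i \<le> t}"
      using set set_take_subset[of l xs] by auto
    hence "card (set (take l xs)) \<le> card {i\<in>{1..m}. q i \<le> t}"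
      by (intro card_mono) auto
    thus ?thesis
      using dist len assms by (simp add: distinct_card)
  qed
  \<comment> \<open>The entry at position \<open>l - 1\<close>, counted from 0, exceeds
    \<open>t\<close>, so all indices with p-value at most \<open>t\<close> lie among the
    \<open>l - 1\<close> entries before it.\<close>
  moreover have "card {i\<in>{1..m}. q i \<le> t} < l" if "\<not> q (xs ! (l - 1)) \<le> t"
  proof -
    have "{i\<in>{1..m}. q i \<le> t} \<subseteq> set (take (l - 1) xs)"
    proof
      fix i assume i: "i \<in> {i\<in>{1..m}. q i \<le> t}"
      hence "i \<in> set xs"
        using set by blast
      then obtain a where a: "a < m" "i = xs ! a"
        using len by (auto simp: in_set_conv_nth)
      hence "a < l - 1"
        using mono[of "l - 1" a] that i by (cases "a < l - 1") auto
      thus "i \<in> set (take (l - 1) xs)"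
        using a len assms by (subst nth_image[symmetric]) auto
    qed
    hence "card {i\<in>{1..m}. q i \<le> t} \<le> card (set (take (l - 1) xs))"
      by (intro card_mono) auto
    also have "\<dots> = l - 1"
      using dist len assms by (simp add: distinct_card)
    finally show ?thesis
      using assms by simp
  qed
  moreover have "ordered_pval m q l = q (xs ! (l - 1))"
    using assms by (simp add: ordered_pval_def xs_def)
  ultimately show ?thesis
    by (metis not_le)
qed

lemma plugin_BH_count_eq:
  "plugin_BH_count m \<alpha> e q = Max {l\<in>{0..m}. l \<le> card {i\<in>{1..m}. q i \<le> real l * \<alpha> / e q}}"
proof -
  have "(ordered_pval m q l \<le> real l * \<alpha> / e q) \<longleftrightarrow>
      (l \<le> card {i\<in>{1..m}. q i \<le> real l * \<alpha> / e q})" if "l \<in> {0..m}" for l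
    \<comment> \<open>At \<open>l = 0\<close> both sides are true: the convention for
      \<open>ordered_pval\<close> and the threshold both give 0.\<close>
    using that ordered_pval_le_iff[of l m q] by (cases "l = 0") (auto simp: ordered_pval_def)
  thus ?thesis
    unfolding plugin_BH_count_def by (metis (no_types, lifting))
qed

text \<open>Expressing maximality by finitely many comparisons prepares the measurability proof.
  Taking \<open>k\<close> to be the count itself yields the inequality that the count
  satisfies.\<close>

lemma plugin_BH_count_eq_iff:
  "plugin_BH_count m \<alpha> e q = k \<longleftrightarrow>
     k \<in> {0..m} \<and> k \<le> card {i\<in>{1..m}. q i \<le> real k * \<alpha> / e q} \<and>
     (\<forall>l\<in>{k<..m}. \<not> l \<le> card {i\<in>{1..m}. q i \<le> real l * \<alpha> / e q})"
  unfolding plugin_BH_count_eq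
  by (subst Max_eq_iff) (auto simp: not_le[symmetric])

lemma plugin_BH_count_le: "plugin_BH_count m \<alpha> e q \<le> m"
  using plugin_BH_count_eq_iff[of m \<alpha> e q "plugin_BH_count m \<alpha> e q"] by simp

text \<open>Larger p-values together with a larger estimator, hence smaller thresholds, leave fewer
  candidates \<open>l\<close> for the maximum.\<close>

lemma plugin_BH_count_antimono:
  assumes "\<And>i. i \<in> {1..m} \<Longrightarrow> q i \<le> q' i" and "0 < e q" "e q \<le> e q'" and "0 \<le> \<alpha>"
  shows "plugin_BH_count m \<alpha> e q' \<le> plugin_BH_count m \<alpha> e q"
proof -
  have "{i\<in>{1..m}. q' i \<le> real l * \<alpha> / e q'} \<subseteq> {i\<in>{1..m}. q i \<le> real l * \<alpha> / e q}" for l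
  proof -
    have "real l * \<alpha> / e q' \<le> real l * \<alpha> / e q"
      using assms by (intro divide_left_mono) auto
    thus ?thesis
      using assms(1) by fastforce
  qed
  hence "card {i\<in>{1..m}. q' i \<le> real l * \<alpha> / e q'} \<le> card {i\<in>{1..m}. q i \<le> real l * \<alpha> / e q}" for l
    by (intro card_mono) simp_all
  hence "{l\<in>{0..m}. l \<le> card {i\<in>{1..m}. q' i \<le> real l * \<alpha> / e q'}} \<subseteq>
      {l\<in>{0..m}. l \<le> card {i\<in>{1..m}. q i \<le> real l * \<alpha> / e q}}"
    using le_trans by blast
  thus ?thesis
    unfolding plugin_BH_count_eq by (rule Max_mono) auto
qed

lemma card_plugin_BH: "card (plugin_BH m \<alpha> e q) = plugin_BH_count m \<alpha> e q"
  using plugin_BH_count_le[of m \<alpha> e q] by (simp add: plugin_BH_def distinct_card)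

text \<open>A rejected index is among the first \<open>k\<close> entries of the sorted list, where
  \<open>k\<close> is the count. Its p-value is thus at most the \<open>k\<close>-th smallest one,
  which meets the threshold.\<close>

lemma plugin_BH_memD:
  assumes "i \<in> plugin_BH m \<alpha> e q"
  shows "1 \<le> plugin_BH_count m \<alpha> e q"
    and "q i \<le> real (plugin_BH_count m \<alpha> e q) * \<alpha> / e q"
proof -
  define k where "k = plugin_BH_count m \<alpha> e q"
  define xs where "xs = ordered_hyps m q"
  obtain a where a: "a < k" "a < m" "i = xs ! a"
    using assms by (auto simp: plugin_BH_def k_def xs_def in_set_conv_nth)
  have "k \<le> m"
    by (simp add: k_def plugin_BH_count_le)
  show "1 \<le> plugin_BH_count m \<alpha> e q"
    using a by (simp add: k_def)
  have "q i \<le> q (xs ! (k - 1))"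
    using sorted_nth_mono[of "map q xs" a "k - 1"] a \<open>k \<le> m\<close>
    by (simp add: xs_def ordered_hyps_def)
  also have "\<dots> = ordered_pval m q k"
    using a by (simp add: ordered_pval_def xs_def)
  also have "\<dots> \<le> real k * \<alpha> / e q"
  proof -
    have "k \<le> card {i\<in>{1..m}. q i \<le> real k * \<alpha> / e q}"
      using plugin_BH_count_eq_iff[of m \<alpha> e q k] by (simp add: k_def)
    thus ?thesis
      using ordered_pval_le_iff[of k m q] a \<open>k \<le> m\<close> by simp
  qed
  finally show "q i \<le> real (plugin_BH_count m \<alpha> e q) * \<alpha> / e q"
    by (simp add: k_def)
qed

section \<open>Measurability of the rejection count\<close>

lemma measurable_countableI:
  fixes f :: "'a \<Rightarrow> 'b :: countable"
  assumes "\<And>k. f -` {k} \<inter> space M \<in> sets M"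
  shows "f \<in> measurable M (count_space UNIV)"
  using assms by (auto simp: measurable_count_space_eq2_countable)

lemma measurable_plugin_BH_count:
  assumes g: "\<And>i. i \<in> {1..m} \<Longrightarrow> (\<lambda>x. g x i) \<in> borel_measurable M"
    and [measurable]: "(\<lambda>x. e (g x)) \<in> borel_measurable M"
  shows "(\<lambda>x. plugin_BH_count m \<alpha> e (g x)) \<in> measurable M (count_space UNIV)"
proof -
  \<comment> \<open>Cardinalities become real sums of indicators, so the event that the count equals
    \<open>k\<close> is a finite combination of comparisons of Borel functions.\<close>
  define s where "s l x = (\<Sum>i\<in>{1..m}. if g x i \<le> real l * \<alpha> / e (g x) then 1 else 0 :: real)" for l x
  have s_eq: "s l x = real (card {i\<in>{1..m}. g x i \<le> real l * \<alpha> / e (g x)})" for l x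
    unfolding s_def by (subst sum.If_cases) (auto simp: Int_def)
  have [measurable]: "s l \<in> borel_measurable M" for l
    unfolding s_def
  proof (rule borel_measurable_sum)
    fix i assume "i \<in> {1..m}"
    note g[OF this, measurable]
    show "(\<lambda>x. if g x i \<le> real l * \<alpha> / e (g x) then 1 else 0 :: real) \<in> borel_measurable M"
      by measurable
  qed
  have "plugin_BH_count m \<alpha> e (g x) = k \<longleftrightarrow>
      k \<in> {0..m} \<and> real k \<le> s k x \<and> (\<forall>l\<in>{k<..m}. \<not> real l \<le> s l x)" for k x
    unfolding plugin_BH_count_eq_iff s_eq of_nat_le_iff ..
  hence pred: "Measurable.pred M (\<lambda>x. plugin_BH_count m \<alpha> e (g x) = k)" for k
    by (simp only:) measurable
  have sets: "(\<lambda>x. plugin_BH_count m \<alpha> e (g x)) -` {k} \<inter> space M \<in> sets M" for k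
  proof -
    have "(\<lambda>x. plugin_BH_count m \<alpha> e (g x)) -` {k} \<inter> space M =
        {x \<in> space M. plugin_BH_count m \<alpha> e (g x) = k}"
      by blast
    thus ?thesis
      using pred[of k] by (simp only: pred_def)
  qed
  show ?thesis
    by (rule measurable_countableI) (rule sets)
qed

section \<open>Comparison of sums of p-values with fair coin flips\<close>

text \<open>Pascal's rule, read as conditioning on one additional coin that shifts the number of
  heads by 0 or 1.\<close>

lemma binomial_sum_Suc:
  fixes a :: "nat \<Rightarrow> real"
  shows "(\<Sum>k\<le>Suc n. real (Suc n choose k) * a k) =
    (\<Sum>k\<le>n. real (n choose k) * a k) + (\<Sum>k\<le>n. real (n choose k) * a (Suc k))"
proof -
  have "(\<Sum>k\<le>Suc n. real (Suc n choose k) * a k) =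
     a 0 + (\<Sum>k\<le>n. real (n choose Suc k) * a (Suc k)) + (\<Sum>k\<le>n. real (n choose k) * a (Suc k))"
    by (subst sum.atMost_Suc_shift) (simp add: algebra_simps sum.distrib)
  also have "a 0 + (\<Sum>k\<le>n. real (n choose Suc k) * a (Suc k)) = (\<Sum>k\<le>Suc n. real (n choose k) * a k)"
    by (subst sum.atMost_Suc_shift) simp
  also have "\<dots> = (\<Sum>k\<le>n. real (n choose k) * a k)"
    by (simp add: binomial_eq_0)
  finally show ?thesis .
qed

text \<open>The absorption identity turns the sum into row \<open>Suc n\<close> of Pascal's triangle
  without its first entry, divided by \<open>Suc n\<close>.\<close>

lemma sum_binomial_div_Suc_le:
  "(\<Sum>k\<le>n. real (n choose k) * (1 / (1 + real k))) \<le> 2 ^ Suc n / real (Suc n)"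
proof -
  have *: "real (n choose k) * (1 / (1 + real k)) = real (Suc n choose Suc k) / real (Suc n)" for k
  proof -
    have "real (Suc n) * real (n choose k) = real (Suc n choose Suc k) * real (Suc k)"
      by (metis Suc_times_binomial_eq of_nat_mult)
    thus ?thesis by (simp add: field_simps del: binomial_Suc_Suc)
  qed
  have "(\<Sum>k\<le>n. real (n choose k) * (1 / (1 + real k))) =
      real (\<Sum>k\<le>n. Suc n choose Suc k) / real (Suc n)"
    by (simp only: * sum_divide_distrib of_nat_sum)
  also have "(\<Sum>k\<le>n. Suc n choose Suc k) \<le> (\<Sum>k\<le>Suc n. Suc n choose k)"
    unfolding sum.atMost_Suc_shift[of "\<lambda>k. Suc n choose k"] by simp
  hence "real (\<Sum>k\<le>n. Suc n choose Suc k) / real (Suc n) \<le> real (2 ^ Suc n) / real (Suc n)"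
    unfolding choose_row_sum by (intro divide_right_mono) (simp_all only: of_nat_le_iff of_nat_0_le_iff)
  finally show ?thesis by simp
qed

text \<open>Convexity: on [0,1] the function \<open>1 / (c + u)\<close> of \<open>u\<close> lies
  below its chord. The weights \<open>1 - u\<close> and \<open>u\<close> are those of a coin with
  mean \<open>u\<close>.\<close>

lemma inverse_le_chord:
  fixes c u :: real
  assumes "0 < c" "0 \<le> u" "u \<le> 1"
  shows "1 / (c + u) \<le> (1 - u) * (1 / c) + u * (1 / (c + 1))"
proof -
  have "(1 - u) * (1 / c) + u * (1 / (c + 1)) - 1 / (c + u) = u * (1 - u) / (c * (c + 1) * (c + u))"
    using assms by (simp add: divide_simps) algebra
  moreover have "0 \<le> u * (1 - u) / (c * (c + 1) * (c + u))"
    using assms by (intro divide_nonneg_nonneg mult_nonneg_nonneg) auto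
  ultimately show ?thesis by linarith
qed

text \<open>The bound is the mean of \<open>1 / (c + B)\<close> for \<open>B\<close> binomial with
  \<open>card J\<close> trials and success probability 1/2. The induction replaces one variable at a
  time by a fair coin; \<open>c\<close> stays arbitrary because a coin showing 1 turns
  \<open>c\<close> into \<open>c + 1\<close>.\<close>

lemma (in prob_space) expectation_inverse_sum_le:
  fixes X :: "'i \<Rightarrow> 'a \<Rightarrow> real"
  assumes "finite J" "indep_vars (\<lambda>_. borel) X J" "0 < c"
    and "\<And>j x. j \<in> J \<Longrightarrow> x \<in> space M \<Longrightarrow> X j x \<in> {0..1}"
    and "\<And>j. j \<in> J \<Longrightarrow> expectation (X j) = 1 / 2"
  shows "expectation (\<lambda>x. 1 / (c + (\<Sum>j\<in>J. X j x))) \<le>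
    (\<Sum>k\<le>card J. real (card J choose k) * (1 / (c + real k))) / 2 ^ card J"
  using assms
proof (induction J arbitrary: c rule: finite_induct)
  case empty
  thus ?case by (simp add: prob_space)
next
  case (insert j J)
  define S where "S x = (\<Sum>i\<in>J. X i x)" for x
  have [measurable]: "X i \<in> borel_measurable M" if "i \<in> insert j J" for i
    using insert.prems(1) that unfolding indep_vars_def by auto
  hence [measurable]: "S \<in> borel_measurable M" "X j \<in> borel_measurable M"
    unfolding S_def by (auto intro!: borel_measurable_sum)
  have range: "X i x \<in> {0..1}" if "i \<in> insert j J" "x \<in> space M" for i x
    using insert.prems(3) that by blast
  have S_nonneg: "0 \<le> S x" if "x \<in> space M" for x
    using range that unfolding S_def by (intro sum_nonneg) force
  have indep: "indep_var borel (X j) borel S"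
    using indep_vars_sum[OF insert.hyps(1,2) insert.prems(1)] by (simp add: S_def[abs_def])
  have int_X: "integrable M (X j)"
    by (intro integrable_const_bound[where B = 1] AE_I2) (use range in force)+
  have int_S: "integrable M (\<lambda>x. 1 / (d + S x))" if "0 < d" for d
  proof (intro integrable_const_bound[where B = "1 / d"] AE_I2)
    fix x assume "x \<in> space M"
    thus "norm (1 / (d + S x)) \<le> 1 / d"
      using S_nonneg[of x] that by (simp add: frac_le)
  qed measurable
  \<comment> \<open>Each of the two terms of the chord is a function of \<open>X j\<close> times a
    function of \<open>S\<close>. Independence factors both, with \<open>f u\<close> being
    \<open>1 - u\<close> or \<open>u\<close> and \<open>d\<close> being \<open>c\<close> or
    \<open>c + 1\<close>.\<close>
  have prod: "expectation (\<lambda>x. f (X j x) * (1 / (d + S x))) = expectation (\<lambda>x. f (X j x)) * expectation (\<lambda>x. 1 / (d + S x))"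
    "integrable M (\<lambda>x. f (X j x) * (1 / (d + S x)))"
    if "0 < d" and [measurable]: "f \<in> borel_measurable borel"
      and "integrable M (\<lambda>x. f (X j x))" for f :: "real \<Rightarrow> real" and d
  proof -
    have "indep_var borel (f \<circ> X j) borel ((\<lambda>s. 1 / (d + s)) \<circ> S)"
      by (intro indep_var_compose[OF indep]) measurable
    hence *: "indep_var borel (\<lambda>x. f (X j x)) borel (\<lambda>x. 1 / (d + S x))"
      by (simp add: comp_def)
    show "expectation (\<lambda>x. f (X j x) * (1 / (d + S x))) = expectation (\<lambda>x. f (X j x)) * expectation (\<lambda>x. 1 / (d + S x))"
      by (rule indep_var_lebesgue_integral[OF * that(3) int_S[OF that(1)]])
    show "integrable M (\<lambda>x. f (X j x) * (1 / (d + S x)))"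
      by (rule indep_var_integrable[OF * that(3) int_S[OF that(1)]])
  qed
  define b where "b d = (\<Sum>k\<le>card J. real (card J choose k) * (1 / (d + real k))) / 2 ^ card J" for d
  have IH: "expectation (\<lambda>x. 1 / (d + S x)) \<le> b d" if "0 < d" for d
    unfolding S_def b_def
    by (rule insert.IH) (use that insert.prems in \<open>auto intro: indep_vars_subset\<close>)
  have half: "expectation (\<lambda>x. 1 - X j x) = 1 / 2" "expectation (X j) = 1 / 2"
    using int_X insert.prems(4)[of j] by (simp_all add: prob_space)
  have "expectation (\<lambda>x. 1 / (c + (\<Sum>i\<in>insert j J. X i x))) =
      expectation (\<lambda>x. 1 / (c + S x + X j x))"
    using insert.hyps by (simp add: S_def add_ac)
  \<comment> \<open>The chord inequality is applied pointwise with \<open>c + S x\<close> in place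
    of \<open>c\<close>.\<close>
  also have "\<dots> \<le> expectation (\<lambda>x. (1 - X j x) * (1 / (c + S x)) + X j x * (1 / (c + 1 + S x)))"
  proof (rule integral_mono_AE')
    show "integrable M (\<lambda>x. (1 - X j x) * (1 / (c + S x)) + X j x * (1 / (c + 1 + S x)))"
      using prod(2)[of c "\<lambda>u. 1 - u"] prod(2)[of "c + 1" "\<lambda>u. u"] int_X insert.prems(2)
      by (intro Bochner_Integration.integrable_add) auto
    show "AE x in M. 1 / (c + S x + X j x) \<le> (1 - X j x) * (1 / (c + S x)) + X j x * (1 / (c + 1 + S x))"
    proof (rule AE_I2)
      fix x assume "x \<in> space M"
      thus "1 / (c + S x + X j x) \<le> (1 - X j x) * (1 / (c + S x)) + X j x * (1 / (c + 1 + S x))"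
        using inverse_le_chord[of "c + S x" "X j x"] S_nonneg[of x] range[of j x] insert.prems(2)
        by (simp add: add_ac)
    qed
    show "AE x in M. 0 \<le> (1 - X j x) * (1 / (c + S x)) + X j x * (1 / (c + 1 + S x))"
    proof (rule AE_I2)
      fix x assume "x \<in> space M"
      thus "0 \<le> (1 - X j x) * (1 / (c + S x)) + X j x * (1 / (c + 1 + S x))"
        using S_nonneg[of x] range[of j x] insert.prems(2)
        by (intro add_nonneg_nonneg mult_nonneg_nonneg) auto
    qed
  qed
  also have "\<dots> = expectation (\<lambda>x. 1 / (c + S x)) / 2 + expectation (\<lambda>x. 1 / (c + 1 + S x)) / 2"
    using prod[of c "\<lambda>u. 1 - u"] prod[of "c + 1" "\<lambda>u. u"] int_X insert.prems(2) half
    by (subst Bochner_Integration.integral_add) auto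
  also have "\<dots> \<le> b c / 2 + b (c + 1) / 2"
    using IH[of c] IH[of "c + 1"] insert.prems(2) by simp
  also have "\<dots> = (\<Sum>k\<le>card (insert j J). real (card (insert j J) choose k) * (1 / (c + real k))) / 2 ^ card (insert j J)"
    unfolding card_insert_disjoint[OF insert.hyps(1,2)] binomial_sum_Suc
    by (simp add: b_def add_divide_distrib add_ac)
  finally show ?case .
qed

text \<open>At \<open>c = 1\<close> the binomial mean has the simple bound from
  \<open>sum_binomial_div_Suc_le\<close>.\<close>

lemma (in prob_space) expectation_inverse_Suc_sum_le:
  fixes X :: "'i \<Rightarrow> 'a \<Rightarrow> real"
  assumes "finite J" "indep_vars (\<lambda>_. borel) X J"
    and "\<And>j x. j \<in> J \<Longrightarrow> x \<in> space M \<Longrightarrow> X j x \<in> {0..1}"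
    and "\<And>j. j \<in> J \<Longrightarrow> expectation (X j) = 1 / 2"
  shows "expectation (\<lambda>x. 1 / (1 + (\<Sum>j\<in>J. X j x))) \<le> 2 / real (Suc (card J))"
proof -
  have "expectation (\<lambda>x. 1 / (1 + (\<Sum>j\<in>J. X j x))) \<le>
      (\<Sum>k\<le>card J. real (card J choose k) * (1 / (1 + real k))) / 2 ^ card J"
    by (rule expectation_inverse_sum_le) (use assms in auto)
  also have "\<dots> \<le> 2 ^ Suc (card J) / real (Suc (card J)) / 2 ^ card J"
    by (intro divide_right_mono sum_binomial_div_Suc_le) auto
  finally show ?thesis by simp
qed

section \<open>Integrals against the uniform distribution\<close>

lemma emeasure_uniform_01_le:
  assumes "0 \<le> c"
  shows "emeasure (uniform_measure lborel {0..1::real}) {0..c} \<le> ennreal c"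
proof -
  have "emeasure (uniform_measure lborel {0..1::real}) {0..c} = emeasure lborel ({0..1} \<inter> {0..c})"
    by (subst emeasure_uniform_measure) (auto simp: divide_ennreal_def)
  also have "\<dots> \<le> emeasure lborel {0..c}"
    by (intro emeasure_mono) auto
  finally show ?thesis using assms by simp
qed

lemma integral_uniform_01: "(\<integral>x. x \<partial>uniform_measure lborel {0..1::real}) = 1 / 2"
proof -
  have "uniform_measure lborel {0..1::real} = density lborel (\<lambda>x. ennreal (indicator {0..1} x))"
    by (simp add: uniform_measure_def ennreal_indicator divide_ennreal_def)
  hence "(\<integral>x. x \<partial>uniform_measure lborel {0..1::real}) = (\<integral>x. indicator {0..1} x *\<^sub>R x \<partial>lborel)"
    by (simp only:) (rule integral_density, auto)
  also have "\<dots> = 1 / 2"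
    using integral_power[of 0 1 1] by (simp add: mult.commute)
  finally show ?thesis .
qed

text \<open>
  The smallest value \<open>v\<close> of \<open>V\<close> on the set \<open>{u. u \<le> c * V u}\<close> satisfies \<open>u \<le> c * v\<close> on that whole
  set, so the integrand is at most \<open>1 / v\<close> on an interval of length at most \<open>c * v\<close>.
\<close>

lemma nn_integral_antimono_le:
  fixes V :: "real \<Rightarrow> nat"
  assumes "0 \<le> c" and anti: "\<And>u u'. 0 \<le> u \<Longrightarrow> u \<le> u' \<Longrightarrow> V u' \<le> V u"
  shows "(\<integral>\<^sup>+u. (if 0 \<le> u \<and> 1 \<le> V u \<and> u \<le> c * real (V u) then ennreal (1 / real (V u)) else 0)
    \<partial>uniform_measure lborel {0..1}) \<le> ennreal c" (is "?I \<le> _")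
proof (cases "\<exists>u. 0 \<le> u \<and> 1 \<le> V u \<and> u \<le> c * real (V u)")
  case True
  define A where "A u \<longleftrightarrow> 0 \<le> u \<and> 1 \<le> V u \<and> u \<le> c * real (V u)" for u
  define v where "v = (LEAST n. \<exists>u. A u \<and> V u = n)"
  have "\<exists>n. \<exists>u. A u \<and> V u = n"
    using True by (auto simp: A_def)
  hence "\<exists>u. A u \<and> V u = v"
    unfolding v_def by (rule LeastI_ex)
  then obtain w where w: "A w" "V w = v" by blast
  have v_le: "v \<le> V u" if "A u" for u
    unfolding v_def by (rule Least_le) (use that in blast)
  have "1 \<le> v" using w by (auto simp: A_def)
  \<comment> \<open>The witness \<open>w\<close> attains the minimum \<open>v\<close>. Points left
    of \<open>w\<close> inherit its bound; for points right of it, antitonicity gives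
    \<open>V u \<le> v\<close>.\<close>
  have bound: "u \<le> c * real v" if "A u" for u
  proof (cases "u \<le> w")
    case True
    thus ?thesis using w by (auto simp: A_def)
  next
    case False
    hence "V u \<le> v" using anti[of w u] w by (auto simp: A_def)
    hence "c * real (V u) \<le> c * real v" using assms(1) by (intro mult_left_mono) auto
    thus ?thesis using that by (auto simp: A_def)
  qed
  have "?I \<le> (\<integral>\<^sup>+u. ennreal (1 / real v) * indicator {0..c * real v} u \<partial>uniform_measure lborel {0..1})"
  proof (rule nn_integral_mono)
    fix u
    have "A u \<Longrightarrow> 1 / real (V u) \<le> 1 / real v"
      using v_le[of u] \<open>1 \<le> v\<close> by (intro divide_left_mono) auto
    thus "(if 0 \<le> u \<and> 1 \<le> V u \<and> u \<le> c * real (V u) then ennreal (1 / real (V u)) else 0)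
        \<le> ennreal (1 / real v) * indicator {0..c * real v} u"
      using bound[of u] unfolding A_def[symmetric]
      by (auto simp: A_def indicator_def intro!: ennreal_leI)
  qed
  also have "\<dots> \<le> ennreal (1 / real v) * ennreal (c * real v)"
    using assms(1) by (subst nn_integral_cmult_indicator) (auto simp del: emeasure_uniform_measure intro!: mult_left_mono emeasure_uniform_01_le)
  also have "\<dots> = ennreal c"
    using \<open>1 \<le> v\<close> assms(1) by (simp flip: ennreal_mult)
  finally show ?thesis .
next
  case False
  have "?I = (\<integral>\<^sup>+u. 0 \<partial>uniform_measure lborel {0..1::real})"
    by (intro nn_integral_cong) (use False in auto)
  thus ?thesis by simp
qed


section \<open>Contribution of a single true null\<close>

lemma m0_PC_new_remove:
  assumes "i \<in> {1..m}"
  shows "m0_PC_new m q = 2 + 2 * (\<Sum>j\<in>{1..m} - {i}. q j) + 2 * q i"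
  using assms by (simp add: m0_PC_new_def sum.remove)

text \<open>Needed because restricting the p-values to the other indices and then updating at
  \<open>i\<close> recovers the original vector only on \<open>{1..m}\<close>.\<close>

lemma plugin_BH_count_PC_cong:
  assumes "\<And>i. i \<in> {1..m} \<Longrightarrow> q i = q' i"
  shows "plugin_BH_count m \<alpha> (m0_PC_new m) q = plugin_BH_count m \<alpha> (m0_PC_new m) q'"
proof -
  have "m0_PC_new m q = m0_PC_new m q'"
    using assms by (simp add: m0_PC_new_def)
  moreover have "{i\<in>{1..m}. q i \<le> t} = {i\<in>{1..m}. q' i \<le> t}" for t
    using assms by auto
  ultimately show ?thesis
    by (simp only: plugin_BH_count_eq)
qed

lemma measurable_plugin_BH_count_PC:
  assumes [measurable]: "\<And>i. i \<in> {1..m} \<Longrightarrow> (\<lambda>x. g x i) \<in> borel_measurable M"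
  shows "(\<lambda>x. plugin_BH_count m \<alpha> (m0_PC_new m) (g x)) \<in> measurable M (count_space UNIV)"
proof (rule measurable_plugin_BH_count[where g = g and e = "m0_PC_new m"])
  show "(\<lambda>x. g x i) \<in> borel_measurable M" if "i \<in> {1..m}" for i
    using assms that by blast
  have "(\<lambda>x. \<Sum>i=1..m. g x i) \<in> borel_measurable M"
    using assms by (rule borel_measurable_sum)
  thus "(\<lambda>x. m0_PC_new m (g x)) \<in> borel_measurable M"
    unfolding m0_PC_new_def by measurable
qed

text \<open>By independence, \<open>p i\<close> can be integrated out first with the other p-values
  fixed. Then \<open>c\<close> is constant and \<open>K\<close> is antitone in \<open>p i\<close>,
  so \<open>nn_integral_antimono_le\<close> bounds the inner integral by \<open>c\<close>.\<close>

lemma (in prob_space) nn_integral_rejection_le: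
  fixes p :: "nat \<Rightarrow> 'a \<Rightarrow> real"
  assumes indep: "indep_vars (\<lambda>_. borel) p {1..m}" and i: "i \<in> {1..m}" and "0 \<le> \<alpha>"
    and range: "\<And>j x. j \<in> {1..m} \<Longrightarrow> x \<in> space M \<Longrightarrow> p j x \<in> {0..1}"
    and unif: "distr M borel (p i) = uniform_measure lborel {0..1}"
  defines "K \<equiv> \<lambda>x. plugin_BH_count m \<alpha> (m0_PC_new m) (\<lambda>j. p j x)"
    and "c \<equiv> \<lambda>x. \<alpha> / (2 + 2 * (\<Sum>j\<in>{1..m} - {i}. p j x))"
  shows "(\<integral>\<^sup>+x. (if 1 \<le> K x \<and> p i x \<le> c x * real (K x) then ennreal (1 / real (K x)) else 0) \<partial>M)
    \<le> (\<integral>\<^sup>+x. ennreal (c x) \<partial>M)"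
proof -
  define J where "J = {1..m} - {i}"
  define L where "L = PiM {i} (\<lambda>_. borel :: real measure)"
  define N where "N = PiM J (\<lambda>_. borel :: real measure)"
  \<comment> \<open>\<open>indep_var\<close> needs variables of one type, so \<open>p i\<close> is wrapped as a function on \<open>{i}\<close>\<close>
  define X where "X x = (\<lambda>j\<in>{i}. p j x)" for x
  define Y where "Y x = (\<lambda>j\<in>J. p j x)" for x
  define V where "V u f = plugin_BH_count m \<alpha> (m0_PC_new m) (f(i := u))" for u and f :: "nat \<Rightarrow> real"
  define C where "C f = \<alpha> / (2 + 2 * (\<Sum>j\<in>J. f j))" for f :: "nat \<Rightarrow> real"
  \<comment> \<open>The conjunct \<open>0 \<le> u\<close> holds automatically at
    \<open>u = p i x\<close>. It confines the antitonicity claim to nonnegative \<open>u\<close>,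
    where the estimator is surely positive.\<close>
  define G where "G u f = (if 0 \<le> u \<and> 1 \<le> V u f \<and> u \<le> C f * real (V u f)
    then ennreal (1 / real (V u f)) else 0)" for u f
  have p_meas: "p j \<in> borel_measurable M" if "j \<in> {1..m}" for j
    using indep that by (auto simp: indep_vars_def)
  have p_i [measurable]: "p i \<in> borel_measurable M"
    using i by (rule p_meas)
  have "indep_var L X N Y"
    unfolding L_def N_def X_def[abs_def] Y_def[abs_def]
    by (rule indep_var_restrict[OF indep]) (use i in \<open>auto simp: J_def\<close>)
  hence [measurable]: "X \<in> measurable M L" "Y \<in> measurable M N"
    and distr_pair: "distr M L X \<Otimes>\<^sub>M distr M N Y = distr M (L \<Otimes>\<^sub>M N) (\<lambda>x. (X x, Y x))"
    unfolding indep_var_distribution_eq by blast+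
  interpret X: prob_space "distr M L X"
    by (rule prob_space_distr) simp
  interpret Y: prob_space "distr M N Y"
    by (rule prob_space_distr) simp
  interpret XY: pair_sigma_finite "distr M L X" "distr M N Y" ..
  have coordinate: "(\<lambda>z. ((snd z)(i := fst z)) j) \<in> borel_measurable (borel \<Otimes>\<^sub>M N)" if "j \<in> {1..m}" for j
    using that by (cases "j = i") (auto simp: N_def J_def)
  have [measurable]: "(\<lambda>z. V (fst z) (snd z)) \<in> measurable (borel \<Otimes>\<^sub>M N) (count_space UNIV)"
    unfolding V_def by (rule measurable_plugin_BH_count_PC) (fact coordinate)
  have [measurable]: "C \<in> borel_measurable N"
    unfolding C_def[abs_def] N_def by measurable
  have G_pair: "(\<lambda>z. G (fst z) (snd z)) \<in> borel_measurable (borel \<Otimes>\<^sub>M N)"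
    unfolding G_def by measurable
  have eval_i: "(\<lambda>e. e i) \<in> borel_measurable L"
    unfolding L_def by simp
  note eval_i [measurable]
  have G [measurable]: "(\<lambda>z. G (fst z i) (snd z)) \<in> borel_measurable (L \<Otimes>\<^sub>M N)"
    using measurable_compose[OF _ G_pair, of "\<lambda>z. (fst z i, snd z)" "L \<Otimes>\<^sub>M N"] by simp
  \<comment> \<open>The integrand sees the wrapped variable only through its coordinate
    \<open>i\<close>, whose law is uniform.\<close>
  have inner: "(\<integral>\<^sup>+e. G (e i) f \<partial>distr M L X) = (\<integral>\<^sup>+u. G u f \<partial>uniform_measure lborel {0..1})"
    if "f \<in> space N" for f
  proof -
    have [measurable]: "(\<lambda>u. G u f) \<in> borel_measurable borel"
      using measurable_compose[OF measurable_Pair2'[OF that] G_pair] by simp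
    have "(\<integral>\<^sup>+e. G (e i) f \<partial>distr M L X) = (\<integral>\<^sup>+x. G (p i x) f \<partial>M)"
      by (subst nn_integral_distr) (simp_all add: X_def)
    also have "\<dots> = (\<integral>\<^sup>+u. G u f \<partial>distr M borel (p i))"
      by (rule nn_integral_distr[symmetric]) simp_all
    finally show ?thesis by (simp only: unif)
  qed
  \<comment> \<open>The components are swapped because the measurability rule for parametrised
    integrals integrates out the second one.\<close>
  have "(\<lambda>(f, e). G (e i) f) \<in> borel_measurable (N \<Otimes>\<^sub>M distr M L X)"
    using measurable_pair_swap[OF G] by (simp cong: measurable_cong_sets sets_pair_measure_cong)
  hence inner_measurable: "(\<lambda>f. \<integral>\<^sup>+e. G (e i) f \<partial>distr M L X) \<in> borel_measurable N"
    by (rule X.borel_measurable_nn_integral)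
  have C_Y: "C (Y x) = c x" for x
    by (simp add: C_def c_def Y_def J_def)
  have V_Y: "V (p i x) (Y x) = K x" for x
    unfolding V_def K_def by (rule plugin_BH_count_PC_cong) (auto simp: Y_def J_def)
  have Y_range: "0 \<le> Y x j" if "x \<in> space M" "j \<in> J" for x j
    using range[of j x] that by (auto simp: Y_def J_def)
  have "(\<integral>\<^sup>+x. (if 1 \<le> K x \<and> p i x \<le> c x * real (K x) then ennreal (1 / real (K x)) else 0) \<partial>M) =
      (\<integral>\<^sup>+x. G (fst (X x, Y x) i) (snd (X x, Y x)) \<partial>M)"
    using range[OF i] by (intro nn_integral_cong) (simp add: G_def V_Y C_Y X_def)
  also have "\<dots> = (\<integral>\<^sup>+z. G (fst z i) (snd z) \<partial>(distr M L X \<Otimes>\<^sub>M distr M N Y))"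
    unfolding distr_pair by (rule nn_integral_distr[symmetric]) measurable
  also have "\<dots> = (\<integral>\<^sup>+f. (\<integral>\<^sup>+e. G (e i) f \<partial>distr M L X) \<partial>distr M N Y)"
    using XY.nn_integral_snd[of "\<lambda>z. G (fst z i) (snd z)"] G by simp
  also have "\<dots> = (\<integral>\<^sup>+x. (\<integral>\<^sup>+e. G (e i) (Y x) \<partial>distr M L X) \<partial>M)"
    using inner_measurable by (intro nn_integral_distr) simp_all
  also have "\<dots> \<le> (\<integral>\<^sup>+x. ennreal (c x) \<partial>M)"
  proof (rule nn_integral_mono)
    fix x assume x: "x \<in> space M"
    have sum_nonneg: "0 \<le> (\<Sum>j\<in>J. Y x j)"
      using Y_range[OF x] by (rule sum_nonneg)
    \<comment> \<open>The estimator is increasing in \<open>u\<close> and at least 2 for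
      \<open>0 \<le> u\<close>, as \<open>plugin_BH_count_antimono\<close> requires.\<close>
    have m0: "m0_PC_new m ((Y x)(i := u)) = 2 + 2 * (\<Sum>j\<in>J. Y x j) + 2 * u" for u
      unfolding m0_PC_new_remove[OF i] J_def by simp
    have "(\<integral>\<^sup>+u. G u (Y x) \<partial>uniform_measure lborel {0..1}) \<le> ennreal (C (Y x))"
      unfolding G_def
    proof (rule nn_integral_antimono_le)
      show "0 \<le> C (Y x)"
        using sum_nonneg \<open>0 \<le> \<alpha>\<close> by (simp add: C_def)
      show "V u' (Y x) \<le> V u (Y x)" if "0 \<le> u" "u \<le> u'" for u u'
        unfolding V_def
        by (rule plugin_BH_count_antimono) (use that sum_nonneg \<open>0 \<le> \<alpha>\<close> in \<open>auto simp: m0\<close>)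
    qed
    moreover have "Y x \<in> space N"
      using x by (rule measurable_space[rotated]) simp
    ultimately show "(\<integral>\<^sup>+e. G (e i) (Y x) \<partial>distr M L X) \<le> ennreal (c x)"
      by (simp only: inner C_Y)
  qed
  finally show ?thesis .
qed

section \<open>Summation over the true nulls\<close>

lemma (in prob_space) FDR_plugin_BH_PC_le:
  fixes p :: "nat \<Rightarrow> 'a \<Rightarrow> real"
  assumes indep: "indep_vars (\<lambda>_. borel) p {1..m}" and N: "N \<subseteq> {1..m}" and "0 \<le> \<alpha>"
    and range: "\<And>j x. j \<in> {1..m} \<Longrightarrow> x \<in> space M \<Longrightarrow> p j x \<in> {0..1}"
    and unif: "\<And>i. i \<in> N \<Longrightarrow> distr M borel (p i) = uniform_measure lborel {0..1}"
  shows "FDR M N (\<lambda>x. plugin_BH m \<alpha> (m0_PC_new m) (\<lambda>j. p j x)) \<le> \<alpha>"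
proof -
  define R where "R x = plugin_BH m \<alpha> (m0_PC_new m) (\<lambda>j. p j x)" for x
  define K where "K x = plugin_BH_count m \<alpha> (m0_PC_new m) (\<lambda>j. p j x)" for x
  define D where "D i x = 2 + 2 * (\<Sum>j\<in>{1..m} - {i}. p j x)" for i x
  \<comment> \<open>\<open>D i\<close> is the estimator with the \<open>i\<close>-th p-value set to
    0, so this threshold is at least the actual one. Hence \<open>g i\<close> dominates the share of
    null \<open>i\<close> in the false discovery proportion.\<close>
  define g where "g i x = (if 1 \<le> K x \<and> p i x \<le> \<alpha> / D i x * real (K x) then 1 / real (K x) else 0)" for i x
  have fin: "finite N"
    using N finite_subset by blast
  have meas [measurable]: "p j \<in> borel_measurable M" if "j \<in> {1..m}" for j
    using indep that by (auto simp: indep_vars_def)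
  have [measurable]: "p j \<in> borel_measurable M" if "j \<in> N" for j
    using meas that N by blast
  have [measurable]: "K \<in> measurable M (count_space UNIV)"
    unfolding K_def by (rule measurable_plugin_BH_count_PC) (fact meas)
  have [measurable]: "D i \<in> borel_measurable M" for i
    unfolding D_def by measurable
  have D_ge: "2 \<le> D i x" if "x \<in> space M" for i x
  proof -
    have "0 \<le> (\<Sum>j\<in>{1..m} - {i}. p j x)"
      using range that by (intro sum_nonneg) force
    thus ?thesis by (simp add: D_def)
  qed
  have g_int: "integrable M (g i)" if "i \<in> N" for i
  proof (intro integrable_const_bound[where B = 1] AE_I2)
    show "g i \<in> borel_measurable M"
      using that unfolding g_def by measurable
  qed (auto simp: g_def)
  have g_le: "expectation (g i) \<le> \<alpha> / real (card N)" if i: "i \<in> N" for i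
  proof -
    have D_int: "integrable M (\<lambda>x. \<alpha> / D i x)"
    proof (intro integrable_const_bound[where B = \<alpha>] AE_I2)
      fix x assume "x \<in> space M"
      hence "\<alpha> / D i x \<le> \<alpha> / 1"
        using D_ge[of x i] \<open>0 \<le> \<alpha>\<close> by (intro divide_left_mono) auto
      thus "norm (\<alpha> / D i x) \<le> \<alpha>"
        using D_ge[OF \<open>x \<in> space M\<close>, of i] \<open>0 \<le> \<alpha>\<close> by simp
    qed measurable
    have "ennreal (expectation (g i)) = (\<integral>\<^sup>+x. ennreal (g i x) \<partial>M)"
      using g_int[OF i] by (intro nn_integral_eq_integral[symmetric]) (auto simp: g_def)
    also have "\<dots> \<le> (\<integral>\<^sup>+x. ennreal (\<alpha> / D i x) \<partial>M)"
      using nn_integral_rejection_le[OF indep _ \<open>0 \<le> \<alpha>\<close> range unif[OF i]] i N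
      by (auto simp: g_def D_def K_def if_distrib[of ennreal] cong: if_cong)
    also have "\<dots> = ennreal (expectation (\<lambda>x. \<alpha> / D i x))"
      using D_int D_ge \<open>0 \<le> \<alpha>\<close>
      by (intro nn_integral_eq_integral AE_I2) (auto intro!: divide_nonneg_nonneg intro: order_trans[of 0 2])
    finally have "expectation (g i) \<le> expectation (\<lambda>x. \<alpha> / D i x)"
      using D_ge \<open>0 \<le> \<alpha>\<close>
      by (subst (asm) ennreal_le_iff)
         (auto intro!: integral_nonneg_AE AE_I2 divide_nonneg_nonneg intro: order_trans[of 0 2])
    \<comment> \<open>The nonnegative p-values of false nulls are dropped from the denominator; the
      remaining ones are uniform.\<close>
    also have "\<dots> \<le> expectation (\<lambda>x. \<alpha> / 2 * (1 / (1 + (\<Sum>j\<in>N - {i}. p j x))))"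
    proof (rule integral_mono_AE')
      have nonneg: "0 \<le> (\<Sum>j\<in>N - {i}. p j x)" if "x \<in> space M" for x
        using range that N by (intro sum_nonneg) force
      have "integrable M (\<lambda>x. 1 / (1 + (\<Sum>j\<in>N - {i}. p j x)))"
        by (intro integrable_const_bound[where B = 1] AE_I2) (use nonneg in \<open>auto simp: divide_le_eq\<close>)
      thus "integrable M (\<lambda>x. \<alpha> / 2 * (1 / (1 + (\<Sum>j\<in>N - {i}. p j x))))"
        by (rule integrable_mult_right)
      show "AE x in M. \<alpha> / D i x \<le> \<alpha> / 2 * (1 / (1 + (\<Sum>j\<in>N - {i}. p j x)))"
      proof (rule AE_I2)
        fix x assume x: "x \<in> space M"
        have "(\<Sum>j\<in>N - {i}. p j x) \<le> (\<Sum>j\<in>{1..m} - {i}. p j x)"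
          using range x N by (intro sum_mono2) force+
        hence "\<alpha> / D i x \<le> \<alpha> / (2 * (1 + (\<Sum>j\<in>N - {i}. p j x)))"
          using nonneg[OF x] \<open>0 \<le> \<alpha>\<close> by (intro divide_left_mono) (auto simp: D_def)
        thus "\<alpha> / D i x \<le> \<alpha> / 2 * (1 / (1 + (\<Sum>j\<in>N - {i}. p j x)))"
          by simp
      qed
      show "AE x in M. 0 \<le> \<alpha> / 2 * (1 / (1 + (\<Sum>j\<in>N - {i}. p j x)))"
        using nonneg \<open>0 \<le> \<alpha>\<close> by (intro AE_I2) simp
    qed
    also have "\<dots> = \<alpha> / 2 * expectation (\<lambda>x. 1 / (1 + (\<Sum>j\<in>N - {i}. p j x)))"
      by (rule integral_mult_right_zero)
    also have "\<dots> \<le> \<alpha> / 2 * (2 / real (Suc (card (N - {i}))))"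
    proof (intro mult_left_mono expectation_inverse_Suc_sum_le)
      show "indep_vars (\<lambda>_. borel) p (N - {i})"
        using indep_vars_subset[OF indep] N by blast
      show "expectation (p j) = 1 / 2" if "j \<in> N - {i}" for j
      proof -
        have "expectation (p j) = (\<integral>u. u \<partial>distr M borel (p j))"
          using that by (subst integral_distr) auto
        thus ?thesis
          using unif[of j] integral_uniform_01 that by simp
      qed
    qed (use fin range N \<open>0 \<le> \<alpha>\<close> in auto)
    also have "\<dots> = \<alpha> / real (card N)"
      using card_Suc_Diff1[OF fin i] by simp
    finally show ?thesis .
  qed
  have "FDR M N R \<le> expectation (\<lambda>x. \<Sum>i\<in>N. g i x)"
    unfolding FDR_def
  \<comment> \<open>Only the nonnegative dominating function has to be integrable: if the false
    discovery proportion were not, its integral would be 0 by convention.\<close>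
  proof (rule integral_mono_AE')
    show "integrable M (\<lambda>x. \<Sum>i\<in>N. g i x)"
      using g_int by (rule Bochner_Integration.integrable_sum)
    show "AE x in M. real (card (R x \<inter> N)) / max 1 (real (card (R x))) \<le> (\<Sum>i\<in>N. g i x)"
    proof (rule AE_I2)
      fix x assume x: "x \<in> space M"
      \<comment> \<open>Each rejected true null carries weight 1 over the number of rejections,
        which is the count \<open>K x\<close>.\<close>
      have "real (card (R x \<inter> N)) / max 1 (real (card (R x))) =
          (\<Sum>i\<in>N. if i \<in> R x then 1 / max 1 (real (K x)) else 0)"
        using fin by (simp add: sum.If_cases card_plugin_BH R_def K_def Int_commute)
      also have "\<dots> \<le> (\<Sum>i\<in>N. g i x)"
      proof (rule sum_mono)
        fix i assume i: "i \<in> N"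
        hence "i \<in> {1..m}" using N by blast
        have "1 \<le> K x \<and> p i x \<le> \<alpha> / D i x * real (K x)" if "i \<in> R x"
        proof -
          have K: "1 \<le> K x" "p i x \<le> real (K x) * \<alpha> / m0_PC_new m (\<lambda>j. p j x)"
            using plugin_BH_memD that unfolding R_def K_def by blast+
          note K(2)
          also have "real (K x) * \<alpha> / m0_PC_new m (\<lambda>j. p j x) \<le> real (K x) * \<alpha> / D i x"
            using D_ge[OF x, of i] range[OF \<open>i \<in> {1..m}\<close> x] \<open>0 \<le> \<alpha>\<close>
            by (intro divide_left_mono) (auto simp: m0_PC_new_remove[OF \<open>i \<in> {1..m}\<close>] D_def)
          finally show ?thesis using K(1) by (simp add: mult.commute)
        qed
        thus "(if i \<in> R x then 1 / max 1 (real (K x)) else 0) \<le> g i x"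
          by (auto simp: g_def)
      qed
      finally show "real (card (R x \<inter> N)) / max 1 (real (card (R x))) \<le> (\<Sum>i\<in>N. g i x)" .
    qed
    show "AE x in M. 0 \<le> (\<Sum>i\<in>N. g i x)"
      by (intro AE_I2 sum_nonneg) (simp add: g_def)
  qed
  also have "\<dots> = (\<Sum>i\<in>N. expectation (g i))"
    using g_int by (rule Bochner_Integration.integral_sum)
  also have "\<dots> \<le> (\<Sum>i\<in>N. \<alpha> / real (card N))"
    using g_le by (rule sum_mono)
  \<comment> \<open>The sum is \<open>\<alpha>\<close> when there are true nulls and 0 when
    \<open>N\<close> is empty.\<close>
  also have "\<dots> \<le> \<alpha>"
    using \<open>0 \<le> \<alpha>\<close> by simp
  finally show ?thesis by (simp add: R_def[abs_def])
qed

theorem mainTheorem2: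
  fixes S :: "'a measure"
    and \<P> :: "'a measure set"
    and m :: nat
    and H :: "nat \<Rightarrow> 'a measure \<Rightarrow> bool"
    and p :: "nat \<Rightarrow> 'a \<Rightarrow> real"
    and \<alpha> :: real
  assumes "0 < \<alpha>" and "\<alpha> < 1"
    and "\<And>P. P \<in> \<P> \<Longrightarrow> prob_space P"
    and "\<And>P. P \<in> \<P> \<Longrightarrow> sets P = sets S"
    and "\<And>i. i \<in> {1..m} \<Longrightarrow> p i \<in> borel_measurable S"
    and "\<And>i x. i \<in> {1..m} \<Longrightarrow> x \<in> space S \<Longrightarrow> p i x \<in> {0..1}"
    and "\<And>P. P \<in> \<P> \<Longrightarrow> prob_space.indep_vars P (\<lambda>_. borel) p {1..m}"
    and "\<And>P i. P \<in> \<P> \<Longrightarrow> i \<in> true_nulls m H P \<Longrightarrow>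
           distr P borel (p i) = uniform_measure lborel {0..1}"
  shows "controls_FDR \<P> m H (\<lambda>x. plugin_BH m \<alpha> (m0_PC_new m) (\<lambda>i. p i x)) \<alpha>"
  unfolding controls_FDR_def
proof
  fix P assume P: "P \<in> \<P>"
  interpret prob_space P by (rule assms(3)[OF P])
  have "space P = space S"
    using assms(4)[OF P] by (rule sets_eq_imp_space_eq)
  thus "FDR P (true_nulls m H P) (\<lambda>x. plugin_BH m \<alpha> (m0_PC_new m) (\<lambda>i. p i x)) \<le> \<alpha>"
    using assms P by (intro FDR_plugin_BH_PC_le) (auto simp: true_nulls_def)
qed

end
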